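(* Let $\mathcal{M},\mathcal{N},\mathcal{S}$ be subspaces of $\mathcal{H}$ satisfying the idempotency condition, and let $E=P_{\mathcal{M},\mathcal{N},\mathcal{S}}$. Then the following are equivalent: (i) $E^*$ and $\overline{E}$ are idempotent; (ii) $(\mathcal{N}^{\perp}+\mathcal{M}^{\perp})\cap\mathcal{S}^{\perp}=(\mathcal{N}^{\perp}\cap\mathcal{S}^{\perp})+(\mathcal{M}^{\perp}\cap\mathcal{S}^{\perp})$ and $$(\overline{\mathcal{M}+\mathcal{S}}+\overline{\mathcal{N}+\mathcal{S}})\cap\overline{\mathcal{M}+\mathcal{N}}=(\overline{\mathcal{M}+\mathcal{S}}\cap\overline{\mathcal{M}+\mathcal{N}})+(\overline{\mathcal{N}+\mathcal{S}}\cap\overline{\mathcal{M}+\mathcal{N}});$$ (iii) $E^*=P_{\mathcal{N}^{\perp}\cap\mathcal{S}^{\perp},\,\mathcal{M}^{\perp}\cap\mathcal{S}^{\perp},\,\mathcal{M}^{\perp}\cap\mathcal{N}^{\perp}}$ and $\overline{E}=P_{\overline{\mathcal{M}+\mathcal{S}}\cap\overline{\mathcal{M}+\mathcal{N}},\ \overline{\mathcal{N}+\mathcal{S}}\cap\overline{\mathcal{M}+\mathcal{N}},\ \overline{\mathcal{M}+\mathcal{S}}\cap\overline{\mathcal{N}+\mathcal{S}}}$.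
   Context: $\mathcal{H}$ is a complex separable Hilbert space; "subspace" means linear subspace, not necessarily closed. A linear relation on $\mathcal{H}$ is a linear subspace $T$ of $\mathcal{H}\times\mathcal{H}$; its closure $\overline{T}$ is taken in $\mathcal{H}\times\mathcal{H}$, and its adjoint is $T^*=\{(x,y)\in\mathcal{H}\times\mathcal{H}:\langle g,x\rangle=\langle f,y\rangle\text{ for all }(f,g)\in T\}$. Product: $ST=\{(x,y): (x,z)\in T,\ (z,y)\in S \text{ for some } z\}$; $T$ is idempotent if $T^2=TT=T$. For subspaces $\mathcal{M},\mathcal{N}$ of $\mathcal{H}$, $P_{\mathcal{M},\mathcal{N}}:=\{(m+n,m): m\in\mathcal{M},\ n\in\mathcal{N}\}$. Subspaces $\mathcal{M},\mathcal{N},\mathcal{S}$ satisfy the idempotency condition if $(\mathcal{M}+\mathcal{N})\cap\mathcal{S}=\mathcal{M}\cap\mathcal{N}$; in that case $P_{\mathcal{M},\mathcal{N},\mathcal{S}}:=P_{\mathcal{M},\mathcal{N}}\ \hat{+}\ (\{0\}\times\mathcal{S})=\{(m+n,m+s):m\in\mathcal{M},n\in\mathcal{N},s\in\mathcal{S}\}$, where $\hat{+}$ is the sum of subspaces of $\mathcal{H}\times\mathcal{H}$ (the notation with three indices is used only for triplets satisfying the idempotency condition; pairwise intersections of any three subspaces do satisfy it). $\mathcal{M}^\perp$ denotes the orthogonal complement in $\mathcal{H}$. *)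

theory Defs
  imports "HOL-Analysis.Analysis" "HOL-Library.Set_Algebras"
begin

text \<open>
  Complex inner product spaces are set up on top of the real ones of the library, the real inner
  product being the real part of the complex one. Thus \<open>inner\<close>, \<open>scaleR\<close>, \<open>norm\<close> and the topology
  are all determined by \<open>scaleC\<close> and \<open>cinner\<close>, and positive definiteness of \<open>cinner\<close> is
  that of \<open>inner\<close>. The product \<open>cinner\<close> is linear in its first argument.
\<close>

class complex_inner = real_inner +
  fixes scaleC :: "complex \<Rightarrow> 'a \<Rightarrow> 'a"  (infixr \<open>*\<^sub>C\<close> 75)
    and cinner :: "'a \<Rightarrow> 'a \<Rightarrow> complex"
  assumes scaleC_add_right: "a *\<^sub>C (x + y) = a *\<^sub>C x + a *\<^sub>C y"
    and scaleC_add_left: "(a + b) *\<^sub>C x = a *\<^sub>C x + b *\<^sub>C x"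
    and scaleC_scaleC: "a *\<^sub>C b *\<^sub>C x = (a * b) *\<^sub>C x"
    and scaleC_one: "1 *\<^sub>C x = x"
    and scaleR_scaleC: "scaleR r x = complex_of_real r *\<^sub>C x"
    and cinner_add_left: "cinner (x + y) z = cinner x z + cinner y z"
    and cinner_scaleC_left: "cinner (a *\<^sub>C x) y = a * cinner x y"
    and cinner_commute: "cinner x y = cnj (cinner y x)"
    and inner_eq_Re_cinner: "inner x y = Re (cinner x y)"

class chilbert_space = complex_inner + complete_space

global_interpretation complex_vector:
  vector_space "scaleC :: complex \<Rightarrow> 'a \<Rightarrow> 'a :: complex_inner"
  by standard (simp_all add: scaleC_add_right scaleC_add_left scaleC_scaleC scaleC_one)

abbreviation csubspace :: "'a :: complex_inner set \<Rightarrow> bool"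
  where "csubspace \<equiv> module.subspace scaleC"

lemma cinner_self:
  fixes x :: "'a :: complex_inner"
  shows "cinner x x = complex_of_real ((norm x)\<^sup>2)"
proof (rule complex_eqI)
  show "Re (cinner x x) = Re (complex_of_real ((norm x)\<^sup>2))"
    by (simp add: power2_norm_eq_inner inner_eq_Re_cinner)
  have "Im (cinner x x) = - Im (cinner x x)"
    using arg_cong[OF cinner_commute[of x x], of Im] by simp
  then show "Im (cinner x x) = Im (complex_of_real ((norm x)\<^sup>2))"
    by simp
qed

instantiation complex :: chilbert_space
begin

definition scaleC_complex :: "complex \<Rightarrow> complex \<Rightarrow> complex"
  where "scaleC_complex a x = a * x"

definition cinner_complex :: "complex \<Rightarrow> complex \<Rightarrow> complex"
  where "cinner_complex x y = x * cnj y"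

instance
  by standard (simp_all add: scaleC_complex_def cinner_complex_def algebra_simps scaleR_conv_of_real
    inner_complex_def)

end

definition orth_comp :: "'a :: complex_inner set \<Rightarrow> 'a set"
  where "orth_comp M = {x. \<forall>m\<in>M. cinner x m = 0}"

text \<open>
  A linear relation is a set of pairs; the product \<open>ST\<close> of the literature (first \<open>T\<close>, then \<open>S\<close>)
  is \<open>T O S\<close>.
\<close>

definition rel_adjoint :: "('a :: complex_inner \<times> 'a) set \<Rightarrow> ('a \<times> 'a) set"
  where "rel_adjoint T = {(x, y). \<forall>(f, g)\<in>T. cinner g x = cinner f y}"

definition idempotent_rel :: "('a \<times> 'a) set \<Rightarrow> bool"
  where "idempotent_rel T \<longleftrightarrow> T O T = T"

definition proj_rel :: "'a :: ab_group_add set \<Rightarrow> 'a set \<Rightarrow> ('a \<times> 'a) set"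
  where "proj_rel M N = {(m + n, m) | m n. m \<in> M \<and> n \<in> N}"

definition idempotency_condition :: "'a :: ab_group_add set \<Rightarrow> 'a set \<Rightarrow> 'a set \<Rightarrow> bool"
  where "idempotency_condition M N S \<longleftrightarrow> (M + N) \<inter> S = M \<inter> N"

text \<open>Meant for triples satisfying \<^const>\<open>idempotency_condition\<close>; the formula itself is total.\<close>

definition proj_rel3 :: "'a :: ab_group_add set \<Rightarrow> 'a set \<Rightarrow> 'a set \<Rightarrow> ('a \<times> 'a) set"
  where "proj_rel3 M N S = proj_rel M N + {0} \<times> S"

lemma proj_rel3_eq: "proj_rel3 M N S = {(m + n, m + s) | m n s. m \<in> M \<and> n \<in> N \<and> s \<in> S}"
  unfolding proj_rel3_def proj_rel_def set_plus_def by fastforce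

text \<open>The index triples in the third condition of the theorem are of the following form.\<close>

lemma idempotency_condition_pairwise_inter:
  fixes A B C :: "'a :: complex_inner set"
  assumes "csubspace A" "csubspace B" "csubspace C"
  shows "idempotency_condition (A \<inter> B) (C \<inter> B) (A \<inter> C)"
proof -
  have "x \<in> C" if "x = m + n" "m \<in> A \<inter> B" "n \<in> C \<inter> B" "x \<in> A \<inter> C" for x m n
    using that by blast
  moreover have "x \<in> B" if "x = m + n" "m \<in> A \<inter> B" "n \<in> C \<inter> B" for x m n
    using that assms(2) complex_vector.subspace_add by blast
  moreover have "x \<in> A \<inter> B + C \<inter> B" if "x \<in> A \<inter> B" for x
    using that assms(2,3) complex_vector.subspace_0 set_plus_intro[of x "A \<inter> B" 0 "C \<inter> B"] by auto
  ultimately show ?thesis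
    unfolding idempotency_condition_def by (auto elim!: set_plus_elim)
qed

end

theory Submission
  imports Defs
begin

text \<open>
  With \<open>A = S\<^sup>\<bottom>\<close>, \<open>B = N\<^sup>\<bottom>\<close>, \<open>C = M\<^sup>\<bottom>\<close> the adjoint of \<open>E\<close> is
  \<open>R = {(x, y). x \<in> A, y \<in> B, x - y \<in> C}\<close>. For any subspaces, \<open>R\<^sup>2\<close> is exactly
  \<open>Q = P\<^bsub>A \<inter> B, A \<inter> C, B \<inter> C\<^esub> \<subseteq> R\<close>, and comparing domains, \<open>R = Q\<close> iff \<open>(B + C) \<inter> A = B \<inter> A + C \<inter> A\<close>.
  The adjoint of \<open>Q\<close> is again of the form \<open>R\<close>, now with the closures of \<open>M + N\<close>, \<open>M + S\<close>,
  \<open>N + S\<close>. So as soon as \<open>E\<^sup>*\<close> is idempotent, the closure \<open>E\<^sup>*\<^sup>*\<close> of \<open>E\<close> is of this form as well, and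
  the same criterion applies to it.
\<close>

section \<open>Double orthogonal complements\<close>

text \<open>By the parallelogram law a minimising sequence in a convex set is Cauchy. Completeness
  then supplies the limit, so no compactness is required.\<close>

lemma closest_point_exists_complete:
  fixes W :: "'a :: {real_inner, complete_space} set"
  assumes "convex W" "closed W" "W \<noteq> {}"
  obtains p where "p \<in> W" "\<forall>w\<in>W. dist x p \<le> dist x w"
proof -
  define d where "d = infdist x W"
  have d_le: "d \<le> dist x w" if "w \<in> W" for w
    using that by (simp add: d_def infdist_le)
  have "d \<ge> 0"
    by (simp add: d_def infdist_nonneg)
  \<comment> \<open>The error is measured in squared distance, matching the parallelogram law
    below.\<close>
  have "\<exists>w\<in>W. (dist x w)\<^sup>2 < d\<^sup>2 + inverse (real (Suc n))" for n
  proof -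
    have "d < sqrt (d\<^sup>2 + inverse (real (Suc n)))"
      by (intro real_less_rsqrt) simp
    then obtain w where "w \<in> W" "dist x w < sqrt (d\<^sup>2 + inverse (real (Suc n)))"
      using assms(3) cINF_less_iff[of W "dist x"] unfolding d_def infdist_notempty[OF assms(3)]
      by auto
    moreover from this have "(dist x w)\<^sup>2 < (sqrt (d\<^sup>2 + inverse (real (Suc n))))\<^sup>2"
      by (intro power_strict_mono) auto
    ultimately show ?thesis
      by auto
  qed
  then obtain v where v: "\<And>n. v n \<in> W"
    and vd: "\<And>n. (dist x (v n))\<^sup>2 < d\<^sup>2 + inverse (real (Suc n))"
    by metis
  have dist_v: "(dist (v m) (v n))\<^sup>2 \<le> 2 * inverse (real (Suc m)) + 2 * inverse (real (Suc n))"
    for m n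
  proof -
    have "midpoint (v m) (v n) \<in> W"
      using assms(1) v by (simp add: midpoint_def scaleR_add_right convex_def)
    then have "d\<^sup>2 \<le> (dist x (midpoint (v m) (v n)))\<^sup>2"
      using d_le \<open>d \<ge> 0\<close> by (intro power_mono) auto
    \<comment> \<open>Parallelogram law for \<open>x - v m\<close> and \<open>x - v n\<close>, whose
      sum is twice \<open>x\<close> minus the midpoint. As the midpoint lies in \<open>W\<close>,
      the terms in \<open>d\<close> cancel in the resulting bound.\<close>
    moreover have "(dist (v m) (v n))\<^sup>2 + 4 * (dist x (midpoint (v m) (v n)))\<^sup>2
        = 2 * (dist x (v m))\<^sup>2 + 2 * (dist x (v n))\<^sup>2"
      by (simp add: dist_norm power2_norm_eq_inner midpoint_def algebra_simps inner_commute)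
    ultimately show ?thesis
      using vd[of m] vd[of n] by linarith
  qed
  have "Cauchy v"
  proof (rule metric_CauchyI)
    fix e :: real assume "e > 0"
    \<comment> \<open>Past \<open>K\<close> each of the two summands in \<open>dist_v\<close> is
      below half of \<open>e\<close> squared.\<close>
    then obtain K where K: "inverse (real (Suc K)) < e\<^sup>2 / 4"
      using reals_Archimedean[of "e\<^sup>2 / 4"] by auto
    have "dist (v m) (v n) < e" if "m \<ge> K" "n \<ge> K" for m n
    proof -
      have "inverse (real (Suc m)) \<le> inverse (real (Suc K))"
        "inverse (real (Suc n)) \<le> inverse (real (Suc K))"
        using that by (auto intro!: le_imp_inverse_le)
      then have "(dist (v m) (v n))\<^sup>2 < e\<^sup>2"
        using dist_v[of m n] K by linarith
      then show ?thesis
        using \<open>e > 0\<close> by (simp add: power_less_imp_less_base)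
    qed
    then show "\<exists>K. \<forall>m\<ge>K. \<forall>n\<ge>K. dist (v m) (v n) < e"
      by blast
  qed
  then obtain p where p: "v \<longlonglongrightarrow> p"
    using Cauchy_convergent convergent_def by blast
  have "p \<in> W"
    using closed_sequentially[OF assms(2)] v p by blast
  have "(\<lambda>n. (dist x (v n))\<^sup>2) \<longlonglongrightarrow> (dist x p)\<^sup>2"
    by (intro tendsto_intros p)
  moreover have "(\<lambda>n. d\<^sup>2 + inverse (real (Suc n))) \<longlonglongrightarrow> d\<^sup>2 + 0"
    by (intro tendsto_intros LIMSEQ_inverse_real_of_nat)
  ultimately have "(dist x p)\<^sup>2 \<le> d\<^sup>2 + 0"
    by (rule LIMSEQ_le) (use vd less_imp_le in blast)
  then have "dist x p \<le> d"
    using \<open>d \<ge> 0\<close> power2_le_imp_le by auto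
  then show ?thesis
    using that[OF \<open>p \<in> W\<close>] d_le by force
qed

lemma subspace_closure:
  fixes V :: "'a :: real_normed_vector set"
  assumes "subspace V"
  shows "subspace (closure V)"
proof (rule subspaceI)
  show "0 \<in> closure V"
    using assms closure_subset subspace_0 by blast
next
  fix x y assume "x \<in> closure V" "y \<in> closure V"
  then obtain f g where f: "\<And>n. f n \<in> V" "f \<longlonglongrightarrow> x" and g: "\<And>n. g n \<in> V" "g \<longlonglongrightarrow> y"
    unfolding closure_sequential by metis
  have "(\<lambda>n. f n + g n) \<longlonglongrightarrow> x + y"
    by (intro tendsto_add f g)
  then show "x + y \<in> closure V"
    unfolding closure_sequential using subspace_add[OF assms f(1) g(1)]
    by (intro exI[of _ "\<lambda>n. f n + g n"]) auto
next
  fix c x assume "x \<in> closure V"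
  then obtain f where f: "\<And>n. f n \<in> V" "f \<longlonglongrightarrow> x"
    unfolding closure_sequential by metis
  have "(\<lambda>n. c *\<^sub>R f n) \<longlonglongrightarrow> c *\<^sub>R x"
    by (intro tendsto_intros f)
  then show "c *\<^sub>R x \<in> closure V"
    unfolding closure_sequential using subspace_scale[OF assms f(1)]
    by (intro exI[of _ "\<lambda>n. c *\<^sub>R f n"]) auto
qed

lemma closed_orthogonal_comp: "closed (orthogonal_comp V)"
proof -
  have "orthogonal_comp V = (\<Inter>y\<in>V. {x. inner y x = 0})"
    by (auto simp: orthogonal_comp_def orthogonal_def)
  then show ?thesis
    by (auto intro!: closed_INT closed_Collect_eq continuous_intros)
qed

text \<open>For \<open>x\<close> in the double complement and \<open>p\<close> its closest point in
  the closure, \<open>x - p\<close> is orthogonal to \<open>V\<close>, hence to \<open>x\<close>,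
  and also to \<open>p\<close>. So it is orthogonal to itself and vanishes.\<close>

lemma orthogonal_comp_orthogonal_comp:
  fixes V :: "'a :: {real_inner, complete_space} set"
  assumes "subspace V"
  shows "orthogonal_comp (orthogonal_comp V) = closure V"
proof
  show "closure V \<subseteq> orthogonal_comp (orthogonal_comp V)"
    by (intro closure_minimal orthogonal_comp_subset closed_orthogonal_comp)
  show "orthogonal_comp (orthogonal_comp V) \<subseteq> closure V"
  proof
    fix x assume x: "x \<in> orthogonal_comp (orthogonal_comp V)"
    have sub: "subspace (closure V)"
      by (rule subspace_closure[OF assms])
    then have "convex (closure V)" "closure V \<noteq> {}"
      using subspace_imp_convex subspace_0[OF sub] by auto
    then obtain p where p: "p \<in> closure V" "\<forall>w\<in>closure V. dist x p \<le> dist x w"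
      using closest_point_exists_complete[of "closure V" x] by auto
    \<comment> \<open>Variational inequality for the closest point, tested at \<open>p + w\<close>;
      applying it to \<open>- w\<close> as well turns it into an equality.\<close>
    have le: "inner (x - p) w \<le> 0" if "w \<in> closure V" for w
      using any_closest_point_dot[OF \<open>convex (closure V)\<close> closed_closure p(1) _ p(2), of "p + w"]
        subspace_add[OF sub p(1) that] by simp
    have orth: "inner (x - p) w = 0" if "w \<in> closure V" for w
      using le[OF that] le[OF subspace_neg[OF sub that]] by simp
    then have "x - p \<in> orthogonal_comp V"
      using closure_subset by (fastforce simp: orthogonal_comp_def orthogonal_def inner_commute)
    then have "inner (x - p) x = 0"
      using x by (simp add: orthogonal_comp_def orthogonal_def)
    then have "inner (x - p) (x - p) = 0"
      using orth[OF p(1)] by (simp add: inner_diff_right)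
    then show "x \<in> closure V"
      using p(1) by simp
  qed
qed

section \<open>Complex subspaces and adjoints in real terms\<close>

lemma csubspace_imp_subspace: "csubspace V \<Longrightarrow> subspace V"
  by (simp add: subspace_def complex_vector.subspace_def scaleR_scaleC)

lemma cinner_zero_left [simp]: "cinner 0 x = 0"
  using cinner_add_left[of 0 0 x] by simp

lemma cinner_zero_right [simp]: "cinner x 0 = 0"
  by (subst cinner_commute) simp

lemma cinner_add_right: "cinner x (y + z) = cinner x y + cinner x z"
  by (metis cinner_add_left cinner_commute complex_cnj_add)

lemma cinner_diff_right: "cinner x (y - z) = cinner x y - cinner x z"
  using cinner_add_right[of x "y - z" z] by simp

lemma cinner_scaleC_right: "cinner x (c *\<^sub>C y) = cnj c * cinner x y"
  by (metis cinner_scaleC_left cinner_commute complex_cnj_mult)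

lemma cinner_eq_zero_commute: "cinner x y = 0 \<longleftrightarrow> cinner y x = 0"
  using cinner_commute[of x y] by simp

text \<open>Multiplying the first argument by \<open>\<i>\<close> moves the imaginary part, up to
  sign, into the real part. Complex equations thus become pairs of real ones.\<close>

lemma cinner_eq_iff_inner:
  "cinner x y = cinner u v \<longleftrightarrow> inner x y = inner u v \<and> inner (\<i> *\<^sub>C x) y = inner (\<i> *\<^sub>C u) v"
  by (auto simp: inner_eq_Re_cinner cinner_scaleC_left complex_eq_iff)

text \<open>A complex subspace contains \<open>\<i> *\<^sub>C m\<close> along with \<open>m\<close>,
  so real orthogonality to it controls both real and imaginary parts.\<close>

lemma orth_comp_eq_orthogonal_comp:
  assumes "csubspace V"
  shows "orth_comp V = orthogonal_comp V"
proof -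
  \<comment> \<open>Zero is written as \<open>cinner 0 0\<close> to fit
    \<open>cinner_eq_iff_inner\<close>, and the arguments are swapped so that \<open>\<i>\<close>
    acts on the element of \<open>V\<close>.\<close>
  have "x \<in> orth_comp V \<longleftrightarrow> (\<forall>m\<in>V. cinner m x = cinner 0 0)" for x
    by (simp add: orth_comp_def cinner_eq_zero_commute[of x])
  moreover have "(\<forall>m\<in>V. cinner m x = cinner 0 0) \<longleftrightarrow> x \<in> orthogonal_comp V" for x
    using complex_vector.subspace_scale[OF assms, of _ \<i>]
    by (auto simp only: orthogonal_comp_def orthogonal_def cinner_eq_iff_inner inner_zero_right
        mem_Collect_eq)
  ultimately show ?thesis
    by blast
qed

lemma csubspace_orth_comp: "csubspace (orth_comp V)"
  by (auto simp: complex_vector.subspace_def orth_comp_def cinner_add_left cinner_scaleC_left)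

lemma csubspace_plus:
  assumes "csubspace U" "csubspace V"
  shows "csubspace (U + V)"
  proof -
  have "U + V = {u + v | u v. u \<in> U \<and> v \<in> V}"
    by (auto simp: set_plus_def)
  then show ?thesis
    using complex_vector.subspace_sums[OF assms] by simp
qed

lemma orth_comp_plus:
  assumes "csubspace U" "csubspace V"
  shows "orth_comp (U + V) = orth_comp U \<inter> orth_comp V"
proof -
  have "U \<subseteq> U + V" "V \<subseteq> U + V"
    using complex_vector.subspace_0[OF assms(1)] complex_vector.subspace_0[OF assms(2)]
      set_plus_intro[of _ U 0 V] set_plus_intro[of 0 U _ V] by force+
  then show ?thesis
    unfolding orth_comp_def by (auto elim!: set_plus_elim simp: cinner_add_right)
qed

text \<open>The intersection is the complement of \<open>U + V\<close>, so the double complement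
  applies. This is the source of the closed sums in the theorem.\<close>

lemma orth_comp_inter_orth_comp:
  fixes U V :: "'a :: chilbert_space set"
  assumes "csubspace U" "csubspace V"
  shows "orth_comp (orth_comp U \<inter> orth_comp V) = closure (U + V)"
proof -
  have "orth_comp (orth_comp U \<inter> orth_comp V) = orth_comp (orth_comp (U + V))"
    by (simp add: orth_comp_plus assms)
  also have "\<dots> = orthogonal_comp (orthogonal_comp (U + V))"
    by (metis orth_comp_eq_orthogonal_comp csubspace_orth_comp csubspace_plus assms)
  also have "\<dots> = closure (U + V)"
    by (intro orthogonal_comp_orthogonal_comp csubspace_imp_subspace csubspace_plus assms)
  finally show ?thesis .
qed

text \<open>Complex linear relations, with pairs viewed in the real inner product space
  \<open>'a \<times> 'a\<close>; stability under \<open>\<i>\<close> restores complex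
  linearity.\<close>

definition csubspace_rel :: "('a :: complex_inner \<times> 'a) set \<Rightarrow> bool"
  where "csubspace_rel T \<longleftrightarrow> subspace T \<and> (\<forall>(f, g)\<in>T. (\<i> *\<^sub>C f, \<i> *\<^sub>C g) \<in> T)"

text \<open>The real part of the adjoint equation says that \<open>(- y, x)\<close> is orthogonal to
  \<open>(f, g)\<close>; stability under \<open>\<i>\<close> yields the imaginary part.\<close>

lemma rel_adjoint_eq_orthogonal_comp:
  assumes "csubspace_rel T"
  shows "rel_adjoint T = {(x, y). (- y, x) \<in> orthogonal_comp T}"
  using assms
  by (fastforce simp: csubspace_rel_def rel_adjoint_def orthogonal_comp_def orthogonal_def
      cinner_eq_iff_inner)

lemma csubspace_rel_rel_adjoint: "csubspace_rel (rel_adjoint T)"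
  by (fastforce simp: csubspace_rel_def subspace_def rel_adjoint_def zero_prod_def
      scaleR_scaleC cinner_add_right cinner_scaleC_right)

text \<open>The rotation taking \<open>(x, y)\<close> to \<open>(- y, x)\<close> squares to minus
  the identity, which preserves subspaces. Hence the double adjoint is the double orthogonal
  complement.\<close>

lemma rel_adjoint_rel_adjoint:
  fixes T :: "('a :: chilbert_space \<times> 'a) set"
  assumes "csubspace_rel T"
  shows "rel_adjoint (rel_adjoint T) = closure T"
proof -
  have "(x, y) \<in> rel_adjoint (rel_adjoint T) \<longleftrightarrow> (x, y) \<in> orthogonal_comp (orthogonal_comp T)"
    for x y
  proof -
    have "(x, y) \<in> rel_adjoint (rel_adjoint T) \<longleftrightarrow>
        (\<forall>f g. (f, g) \<in> rel_adjoint T \<longrightarrow> inner g x = inner f y)"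
      unfolding rel_adjoint_eq_orthogonal_comp[OF csubspace_rel_rel_adjoint]
      by (auto simp: orthogonal_comp_def orthogonal_def)
    also have "\<dots> \<longleftrightarrow> (\<forall>f g. (- g, f) \<in> orthogonal_comp T \<longrightarrow> inner g x = inner f y)"
      by (simp add: rel_adjoint_eq_orthogonal_comp[OF assms])
    \<comment> \<open>Substitution of \<open>a\<close> for \<open>- g\<close> and \<open>b\<close>
      for \<open>f\<close>.\<close>
    also have "\<dots> \<longleftrightarrow> (\<forall>a b. (a, b) \<in> orthogonal_comp T \<longrightarrow> inner (- a) x = inner b y)"
      by (metis minus_minus)
    also have "\<dots> \<longleftrightarrow> (x, y) \<in> orthogonal_comp (orthogonal_comp T)"
      unfolding orthogonal_comp_def[of "orthogonal_comp T"] orthogonal_def by fastforce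
    finally show ?thesis .
  qed
  then show ?thesis
    using orthogonal_comp_orthogonal_comp[of T] assms by (auto simp: csubspace_rel_def)
qed

section \<open>The relations determined by three subspaces\<close>

lemma csubspace_rel_proj_rel3:
  assumes "csubspace M" "csubspace N" "csubspace S"
  shows "csubspace_rel (proj_rel3 M N S)"
proof -
  have mem: "p \<in> proj_rel3 M N S" if "p = (m + n, m + s)" "m \<in> M" "n \<in> N" "s \<in> S" for p m n s
    using that by (auto simp: proj_rel3_eq)
  note sub = csubspace_imp_subspace[OF assms(1)] csubspace_imp_subspace[OF assms(2)]
    csubspace_imp_subspace[OF assms(3)]
  show ?thesis
    unfolding csubspace_rel_def
  proof (intro conjI subspaceI)
    show "0 \<in> proj_rel3 M N S"
      by (rule mem[of _ 0 0 0]) (auto simp: zero_prod_def intro: subspace_0 sub)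
  next
    fix p q assume "p \<in> proj_rel3 M N S" "q \<in> proj_rel3 M N S"
    then obtain m n s m' n' s' where "p = (m + n, m + s)" "q = (m' + n', m' + s')"
      "m \<in> M" "n \<in> N" "s \<in> S" "m' \<in> M" "n' \<in> N" "s' \<in> S"
      by (auto simp: proj_rel3_eq)
    then show "p + q \<in> proj_rel3 M N S"
      by (intro mem[of _ "m + m'" "n + n'" "s + s'"]) (auto intro: subspace_add sub)
  next
    fix c p assume "p \<in> proj_rel3 M N S"
    then obtain m n s where "p = (m + n, m + s)" "m \<in> M" "n \<in> N" "s \<in> S"
      by (auto simp: proj_rel3_eq)
    then show "c *\<^sub>R p \<in> proj_rel3 M N S"
      by (intro mem[of _ "c *\<^sub>R m" "c *\<^sub>R n" "c *\<^sub>R s"])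
        (auto simp: scaleR_add_right intro: subspace_scale sub)
  next
    show "\<forall>(f, g)\<in>proj_rel3 M N S. (\<i> *\<^sub>C f, \<i> *\<^sub>C g) \<in> proj_rel3 M N S"
      using assms[THEN complex_vector.subspace_scale]
      by (fastforce simp: proj_rel3_eq scaleC_add_right)
  qed
qed

text \<open>Membership is a system of three conditions instead of a choice of summands, which is the
  shape an adjoint takes.\<close>

definition cross_rel :: "'a :: ab_group_add set \<Rightarrow> 'a set \<Rightarrow> 'a set \<Rightarrow> ('a \<times> 'a) set"
  where "cross_rel A B C = {(x, y). x \<in> A \<and> y \<in> B \<and> x - y \<in> C}"

text \<open>Setting two of \<open>m\<close>, \<open>n\<close>, \<open>s\<close> to zero isolates one
  condition each: \<open>s\<close> constrains \<open>x\<close>, \<open>n\<close> constrains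
  \<open>y\<close>, and \<open>m\<close> constrains \<open>x - y\<close>. By linearity the three
  together suffice.\<close>

lemma rel_adjoint_proj_rel3:
  assumes "csubspace M" "csubspace N" "csubspace S"
  shows "rel_adjoint (proj_rel3 M N S) = cross_rel (orth_comp S) (orth_comp N) (orth_comp M)"
proof (intro equalityI subsetI)
  fix p assume "p \<in> rel_adjoint (proj_rel3 M N S)"
  then obtain x y where p: "p = (x, y)"
    and eq: "\<And>m n s. \<lbrakk>m \<in> M; n \<in> N; s \<in> S\<rbrakk> \<Longrightarrow> cinner (m + s) x = cinner (m + n) y"
    by (fastforce simp: rel_adjoint_def proj_rel3_eq)
  note zero = assms[THEN complex_vector.subspace_0]
  have "cinner s x = 0" if "s \<in> S" for s
    using eq[OF zero(1,2) that] by simp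
  moreover have "cinner n y = 0" if "n \<in> N" for n
    using eq[OF zero(1) that zero(3)] by simp
  moreover have "cinner m (x - y) = 0" if "m \<in> M" for m
    using eq[OF that zero(2,3)] by (simp add: cinner_diff_right)
  ultimately show "p \<in> cross_rel (orth_comp S) (orth_comp N) (orth_comp M)"
    by (simp add: p cross_rel_def orth_comp_def cinner_eq_zero_commute[of x]
        cinner_eq_zero_commute[of y] cinner_eq_zero_commute[of "x - y"])
next
  fix p assume "p \<in> cross_rel (orth_comp S) (orth_comp N) (orth_comp M)"
  then obtain x y where p: "p = (x, y)" and "\<And>s. s \<in> S \<Longrightarrow> cinner s x = 0"
    "\<And>n. n \<in> N \<Longrightarrow> cinner n y = 0" "\<And>m. m \<in> M \<Longrightarrow> cinner m (x - y) = 0"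
    unfolding cross_rel_def orth_comp_def using cinner_eq_zero_commute by blast
  then show "p \<in> rel_adjoint (proj_rel3 M N S)"
    by (auto simp: rel_adjoint_def proj_rel3_eq cinner_add_left cinner_diff_right)
qed

text \<open>The intermediate point of a composite pair is the common summand \<open>m\<close>; the
  two differences from it are \<open>n\<close> and \<open>s\<close>.\<close>

lemma cross_rel_O_cross_rel:
  assumes "subspace A" "subspace B" "subspace C"
  shows "cross_rel A B C O cross_rel A B C = proj_rel3 (B \<inter> A) (C \<inter> A) (C \<inter> B)"
proof (intro equalityI subsetI)
  fix p assume "p \<in> cross_rel A B C O cross_rel A B C"
  then obtain x y z where p: "p = (x, z)" and "x \<in> A" "y \<in> B" "x - y \<in> C" "y \<in> A" "z \<in> B" "y - z \<in> C"
    by (auto simp: cross_rel_def)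
  then have "y \<in> B \<inter> A" "x - y \<in> C \<inter> A" "z - y \<in> C \<inter> B"
    using assms subspace_diff subspace_neg[of C "y - z"] by auto
  then show "p \<in> proj_rel3 (B \<inter> A) (C \<inter> A) (C \<inter> B)"
    unfolding p proj_rel3_eq by (intro CollectI exI[of _ y] exI[of _ "x - y"] exI[of _ "z - y"]) auto
next
  fix p assume "p \<in> proj_rel3 (B \<inter> A) (C \<inter> A) (C \<inter> B)"
  then obtain m n s where p: "p = (m + n, m + s)" and "m \<in> B \<inter> A" "n \<in> C \<inter> A" "s \<in> C \<inter> B"
    by (auto simp: proj_rel3_eq)
  then have "(m + n, m) \<in> cross_rel A B C" "(m, m + s) \<in> cross_rel A B C"
    using assms by (auto simp: cross_rel_def subspace_add subspace_neg)
  then show "p \<in> cross_rel A B C O cross_rel A B C"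
    unfolding p by blast
qed

lemma idempotent_cross_rel_iff:
  assumes "subspace A" "subspace B" "subspace C"
  shows "idempotent_rel (cross_rel A B C) \<longleftrightarrow> cross_rel A B C = proj_rel3 (B \<inter> A) (C \<inter> A) (C \<inter> B)"
  unfolding idempotent_rel_def cross_rel_O_cross_rel[OF assms] by blast

text \<open>The two sides of the distributive identity are the domains of the two relations. Equal
  domains suffice, because the second relation lies in the first and both relate 0 to exactly
  \<open>C \<inter> B\<close>.\<close>

lemma cross_rel_eq_proj_rel3_iff:
  assumes "subspace A" "subspace B" "subspace C"
  shows "cross_rel A B C = proj_rel3 (B \<inter> A) (C \<inter> A) (C \<inter> B) \<longleftrightarrow>
    (B + C) \<inter> A = (B \<inter> A) + (C \<inter> A)"
proof
  assume eq: "cross_rel A B C = proj_rel3 (B \<inter> A) (C \<inter> A) (C \<inter> B)"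
  show "(B + C) \<inter> A = (B \<inter> A) + (C \<inter> A)"
  proof (intro equalityI subsetI)
    fix x assume "x \<in> (B + C) \<inter> A"
    then obtain b c where "x = b + c" "b \<in> B" "c \<in> C" "x \<in> A"
      by (auto elim: set_plus_elim)
    then have "(x, b) \<in> cross_rel A B C"
      by (simp add: cross_rel_def)
    then show "x \<in> (B \<inter> A) + (C \<inter> A)"
      unfolding eq proj_rel3_eq by (auto intro: set_plus_intro)
  qed (use assms in \<open>auto elim!: set_plus_elim intro: set_plus_intro subspace_add\<close>)
next
  assume eq: "(B + C) \<inter> A = (B \<inter> A) + (C \<inter> A)"
  show "cross_rel A B C = proj_rel3 (B \<inter> A) (C \<inter> A) (C \<inter> B)"
  proof (intro equalityI subsetI)
    fix p assume "p \<in> cross_rel A B C"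
    then obtain x y where p: "p = (x, y)" "x \<in> A" "y \<in> B" "x - y \<in> C"
      by (auto simp: cross_rel_def)
    then have "x \<in> (B + C) \<inter> A"
      using set_plus_intro[of y B "x - y" C] by simp
    then obtain m n where mn: "x = m + n" "m \<in> B \<inter> A" "n \<in> C \<inter> A"
      unfolding eq by (auto elim: set_plus_elim)
    have "y - m \<in> B"
      using p(3) mn(2) assms(2) by (blast intro: subspace_diff)
    \<comment> \<open>Since \<open>x = m + n\<close>, this element is \<open>y - m\<close>, the
      value forced on the third summand.\<close>
    moreover have "n - (x - y) \<in> C"
      using p(4) mn(3) assms(3) by (blast intro: subspace_diff)
    ultimately have "y - m \<in> C \<inter> B"
      using mn(1) by (simp add: algebra_simps)
    moreover have "p = (m + n, m + (y - m))"
      using p mn by simp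
    ultimately show "p \<in> proj_rel3 (B \<inter> A) (C \<inter> A) (C \<inter> B)"
      unfolding proj_rel3_eq using mn by blast
  next
    fix p assume "p \<in> proj_rel3 (B \<inter> A) (C \<inter> A) (C \<inter> B)"
    then show "p \<in> cross_rel A B C"
      using assms by (auto simp: proj_rel3_eq cross_rel_def subspace_add subspace_diff)
  qed
qed

theorem corollary5p14:
  fixes M N S :: "'a :: chilbert_space set"
    and E :: "('a \<times> 'a) set"
  assumes "separable_space (euclidean :: 'a topology)"
    and "csubspace M" and "csubspace N" and "csubspace S"
    and "idempotency_condition M N S"
    and "E = proj_rel3 M N S"
  shows "(idempotent_rel (rel_adjoint E) \<and> idempotent_rel (closure E)
      \<longleftrightarrow>
      (orth_comp N + orth_comp M) \<inter> orth_comp S =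
        (orth_comp N \<inter> orth_comp S) + (orth_comp M \<inter> orth_comp S) \<and>
      (closure (M + S) + closure (N + S)) \<inter> closure (M + N) =
        (closure (M + S) \<inter> closure (M + N)) + (closure (N + S) \<inter> closure (M + N)))
    \<and>
    (idempotent_rel (rel_adjoint E) \<and> idempotent_rel (closure E)
      \<longleftrightarrow>
      rel_adjoint E = proj_rel3 (orth_comp N \<inter> orth_comp S)
                                (orth_comp M \<inter> orth_comp S)
                                (orth_comp M \<inter> orth_comp N) \<and>
      closure E = proj_rel3 (closure (M + S) \<inter> closure (M + N))
                            (closure (N + S) \<inter> closure (M + N))
                            (closure (M + S) \<inter> closure (N + S)))"
proof -
  define A B C where "A = orth_comp S" and "B = orth_comp N" and "C = orth_comp M"
  \<comment> \<open>The order follows \<open>rel_adjoint_proj_rel3\<close> applied to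
    \<open>proj_rel3 (B \<inter> A) (C \<inter> A) (C \<inter> B)\<close>: complements of the third,
    second and first index.\<close>
  define A' B' C' where "A' = closure (M + N)" and "B' = closure (M + S)" and "C' = closure (N + S)"
  have csub: "csubspace A" "csubspace B" "csubspace C"
    by (simp_all add: A_def B_def C_def csubspace_orth_comp)
  note sub = csub[THEN csubspace_imp_subspace]
  have closures: "orth_comp (C \<inter> B) = A'" "orth_comp (C \<inter> A) = B'" "orth_comp (B \<inter> A) = C'"
    by (simp_all add: A_def B_def C_def A'_def B'_def C'_def orth_comp_inter_orth_comp assms(2-4))
  then have sub': "subspace A'" "subspace B'" "subspace C'"
    by (metis csubspace_imp_subspace csubspace_orth_comp)+
  have adj: "rel_adjoint E = cross_rel A B C"
    by (simp add: assms(2-4,6) rel_adjoint_proj_rel3 A_def B_def C_def)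
  have clo: "closure E = cross_rel A' B' C'" if "cross_rel A B C = proj_rel3 (B \<inter> A) (C \<inter> A) (C \<inter> B)"
  proof -
    have "closure E = rel_adjoint (rel_adjoint E)"
      by (simp add: assms(2-4,6) rel_adjoint_rel_adjoint csubspace_rel_proj_rel3)
    also have "\<dots> = rel_adjoint (proj_rel3 (B \<inter> A) (C \<inter> A) (C \<inter> B))"
      by (simp add: adj that)
    also have "\<dots> = cross_rel A' B' C'"
      by (simp add: rel_adjoint_proj_rel3 complex_vector.subspace_inter csub closures)
    finally show ?thesis .
  qed
  note idem = idempotent_cross_rel_iff[OF sub] idempotent_cross_rel_iff[OF sub']
  note dist = cross_rel_eq_proj_rel3_iff[OF sub] cross_rel_eq_proj_rel3_iff[OF sub']
  \<comment> \<open>In each of the three conditions of the theorem the first conjunct yields the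
    premise of \<open>clo\<close>, so \<open>closure E\<close> may be replaced by
    \<open>cross_rel A' B' C'\<close> in every direction.\<close>
  have "idempotent_rel (rel_adjoint E) \<and> idempotent_rel (closure E) \<longleftrightarrow>
      (B + C) \<inter> A = (B \<inter> A) + (C \<inter> A) \<and> (B' + C') \<inter> A' = (B' \<inter> A') + (C' \<inter> A')"
    using clo idem dist by (metis adj)
  moreover have "idempotent_rel (rel_adjoint E) \<and> idempotent_rel (closure E) \<longleftrightarrow>
      rel_adjoint E = proj_rel3 (B \<inter> A) (C \<inter> A) (C \<inter> B) \<and>
      closure E = proj_rel3 (B' \<inter> A') (C' \<inter> A') (B' \<inter> C')"
    \<comment> \<open>Commutativity reorders the third index of the closure,
      \<open>C' \<inter> B'\<close> in the criterion.\<close>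
    using clo idem by (metis adj Int_commute)
  ultimately show ?thesis
    unfolding A_def B_def C_def A'_def B'_def C'_def by blast
qed

end
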